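(* Let $k \ge d$ be positive integers and $v_1, \ldots, v_k$ be directions in $\mathbb{R}^d$. Given a family $\mathcal{F}$ of $(r-1)(k+d)+1$ zonotopes with directions $v_1, \ldots, v_k$, each of volume at least one, where $r$ is a positive integer, there exists a partition of $\mathcal{F}$ into $r$ parts $\mathcal{A}_1, \ldots, \mathcal{A}_r$ such that $\bigcap_{j=1}^r \operatorname{conv}\left(\bigcup \mathcal{A}_j\right)$ contains a zonotope with directions $v_1, \ldots, v_k$ of volume at least one.
   Context: Directions are nonzero vectors. A zonotope with directions $v_1, \ldots, v_k$ is a set $p + \big((\alpha_1 v_1) \oplus \cdots \oplus (\alpha_k v_k)\big)$ with $p \in \mathbb{R}^d$, $\alpha_i \ge 0$, where $\alpha_i v_i$ denotes the segment from $0$ to $\alpha_i v_i$ and $\oplus$ is the Minkowski sum. $\operatorname{conv}$ is the convex hull. *)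

theory Defs
  imports "HOL-Analysis.Analysis" "HOL-Library.Disjoint_Sets" "HOL-Library.Set_Algebras"
begin

text \<open>The sum over \<open>i\<close> is the Minkowski sum of sets.\<close>

definition is_zonotope :: "nat \<Rightarrow> (nat \<Rightarrow> real ^ 'n) \<Rightarrow> (real ^ 'n) set \<Rightarrow> bool" where
  "is_zonotope k v Z \<longleftrightarrow>
    (\<exists>p \<alpha>. (\<forall>i\<in>{1..k}. 0 \<le> \<alpha> i) \<and>
       Z = (+) p ` (\<Sum>i\<in>{1..k}. closed_segment 0 (\<alpha> i *\<^sub>R v i)))"

end

theory Submission
  imports Defs
begin

text \<open>
  A zonotope is described by its base point and its \<open>k\<close> lengths, a point of a \<open>(d + k)\<close>-dimensional
  space. The zonotope of a convex combination of such points lies in the convex hull of the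
  zonotopes involved, and by the Brunn--Minkowski inequality it has volume at least one if they
  all do. Forget the last length and apply Tverberg's theorem in dimension \<open>d + k - 1\<close>: the
  \<open>r\<close> parts then have convex combinations that differ in the last length only. The corresponding
  zonotopes are nested, and the smallest of them is contained in all \<open>r\<close> convex hulls.
\<close>

section \<open>Tverberg's theorem\<close>

text \<open>Tverberg's theorem in dimension \<open>D\<close> asks for
  \<open>(r - 1) * (D + 1) + 1\<close> points, so \<open>D = d + k - 1\<close> gives exactly the
  stated count; keeping all \<open>d + k\<close> parameters would cost \<open>r - 1\<close> further
  zonotopes. All segments start at 0 and lengths are nonnegative, so base points and lengths add
  under Minkowski addition: convex combinations of parameters are Minkowski combinations of
  zonotopes. Volume is not linear in the parameters, but it is enough that the parameters of volume
  at least one form a convex set. The multiplicative form of Brunn-Minkowski, with exponents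
  \<open>1 - t\<close> and \<open>t\<close>, yields this at once. It also suits a proof by cutting:
  the exponents add up to 1, so multiplying both volumes by \<open>q\<close> multiplies the lower
  bound by \<open>q\<close>.\<close>

lemma homogeneous_system_nontrivial_solution:
  fixes x :: "'i \<Rightarrow> 'q \<Rightarrow> real"
  assumes "finite Q" "finite I" "card Q < card I"
  shows "\<exists>d. (\<exists>i\<in>I. d i \<noteq> 0) \<and> (\<forall>q\<in>Q. (\<Sum>i\<in>I. d i * x i q) = 0)"
  using assms
proof (induction Q arbitrary: I x rule: finite_induct)
  case empty
  then obtain i where "i \<in> I" by fastforce
  then show ?case by (intro exI[of _ "\<lambda>_. 1"]) auto
next
  case (insert q Q)
  show ?case
  proof (cases "\<forall>i\<in>I. x i q = 0")
    case True
    have "card Q < card I" using insert by simp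
    from insert.IH[OF \<open>finite I\<close> this] obtain d where
      "\<exists>i\<in>I. d i \<noteq> 0" "\<forall>q\<in>Q. (\<Sum>i\<in>I. d i * x i q) = 0" by blast
    then show ?thesis using True by (intro exI[of _ d]) auto
  next
    case False
    then obtain j where j: "j \<in> I" "x j q \<noteq> 0" by blast
    \<comment> \<open>One step of Gaussian elimination: equation \<open>q\<close> is solved for
      unknown \<open>j\<close>, and \<open>y\<close> is the system left in the other unknowns.
      Back-substitution in \<open>e\<close> recovers the value at \<open>j\<close>.\<close>
    define y where "y i p = x i p - x i q / x j q * x j p" for i p
    have "card Q < card (I - {j})" "finite (I - {j})"
      using insert j by auto
    from insert.IH[OF this(2,1), of y] obtain d where
      d: "\<exists>i\<in>I - {j}. d i \<noteq> 0" "\<forall>p\<in>Q. (\<Sum>i\<in>I - {j}. d i * y i p) = 0" by blast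
    define e where "e = d(j := - (\<Sum>i\<in>I - {j}. d i * x i q) / x j q)"
    have eq: "(\<Sum>i\<in>I. e i * x i p) = (\<Sum>i\<in>I - {j}. d i * y i p)" for p
    proof -
      have "(\<Sum>i\<in>I. e i * x i p) = e j * x j p + (\<Sum>i\<in>I - {j}. e i * x i p)"
        using j insert.prems by (simp add: sum.remove)
      also have "(\<Sum>i\<in>I - {j}. e i * x i p) = (\<Sum>i\<in>I - {j}. d i * x i p)"
        by (intro sum.cong) (auto simp: e_def)
      also have "e j * x j p = - (\<Sum>i\<in>I - {j}. d i * (x i q / x j q * x j p))"
        by (simp add: e_def sum_distrib_right sum_divide_distrib mult.assoc)
      finally show ?thesis
        by (simp add: y_def algebra_simps sum_subtractf)
    qed
    have "y i q = 0" for i using j by (simp add: y_def)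
    then have "\<forall>p\<in>insert q Q. (\<Sum>i\<in>I. e i * x i p) = 0"
      using d(2) by (simp add: eq)
    moreover have "\<exists>i\<in>I. e i \<noteq> 0" using d(1) by (auto simp: e_def)
    ultimately show ?thesis by blast
  qed
qed

text \<open>Weights are functions on the whole index type, where compactness comes from the product
  topology (Tychonoff). Pinning them to 0 outside \<open>I\<close> makes the simplex a closed subset
  of a compact product.\<close>

lemma simplex_minimum:
  fixes f :: "('i \<Rightarrow> real) \<Rightarrow> real"
  assumes "finite I" "I \<noteq> {}" "continuous_on UNIV f"
  obtains w where "\<forall>i\<in>I. 0 \<le> w i" "sum w I = 1"
    "\<And>u. (\<forall>i\<in>I. 0 \<le> u i) \<Longrightarrow> sum u I = 1 \<Longrightarrow> (\<forall>i. i \<notin> I \<longrightarrow> u i = 0) \<Longrightarrow> f w \<le> f u"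
proof -
  define K where "K = PiE UNIV (\<lambda>i. if i \<in> I then {0..1::real} else {0})"
  define D where "D = K \<inter> {w. sum w I = 1}"
  have "compact K"
    unfolding K_def
    using compactin_PiE[of "\<lambda>_. euclidean" "UNIV :: 'i set" "\<lambda>i. if i \<in> I then {0..1::real} else {0}"]
    by (auto simp: euclidean_product_topology)
  moreover have "closed {w :: 'i \<Rightarrow> real. sum w I = 1}"
    by (intro closed_Collect_eq continuous_intros continuous_on_product_coordinates)
  ultimately have "compact D" unfolding D_def by blast
  have Diff: "w \<in> D \<longleftrightarrow> (\<forall>i\<in>I. 0 \<le> w i) \<and> sum w I = 1 \<and> (\<forall>i. i \<notin> I \<longrightarrow> w i = 0)" for w
  proof -
    have "w i \<le> 1" if "i \<in> I" "\<forall>i\<in>I. 0 \<le> w i" "sum w I = 1" for i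
      using that assms(1) member_le_sum[of i I w] by simp
    then show ?thesis
      by (auto simp: D_def K_def PiE_iff split: if_splits)
  qed
  obtain a where "a \<in> I" using assms by blast
  then have "(\<lambda>i. if i = a then 1 else 0) \<in> D"
    using assms(1) by (auto simp: Diff)
  then have "D \<noteq> {}" by blast
  obtain w where "w \<in> D" "\<forall>u\<in>D. f w \<le> f u"
    using continuous_attains_inf[OF \<open>compact D\<close> \<open>D \<noteq> {}\<close>] assms(3) continuous_on_subset by blast
  then show thesis using that[of w] by (auto simp: Diff)
qed

text \<open>A linear dependence \<open>d\<close> suffices here, where an affine one would need one
  more point. Moving the weights along \<open>d\<close> fixes \<open>z\<close> but changes the total
  weight; normalising then divides \<open>z\<close> by that total. A total above 1 would bring the
  point closer to the origin, so minimality forces the total to stay 1.\<close>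

lemma convex_combination_avoiding_index:
  fixes x :: "'i \<Rightarrow> 'q \<Rightarrow> real" and w :: "'i \<Rightarrow> real"
  assumes fin: "finite Q" "finite I" "card Q < card I"
    and w: "\<forall>i\<in>I. 0 \<le> w i" "sum w I = 1"
    and z: "z = (\<lambda>q. \<Sum>i\<in>I. w i * x i q)"
    and nz: "(\<Sum>q\<in>Q. (z q)\<^sup>2) > 0"
    and min: "\<And>u. (\<forall>i\<in>I. 0 \<le> u i) \<Longrightarrow> sum u I = 1 \<Longrightarrow>
      (\<Sum>q\<in>Q. (z q)\<^sup>2) \<le> (\<Sum>q\<in>Q. (\<Sum>i\<in>I. u i * x i q)\<^sup>2)"
  obtains u a where "\<forall>i\<in>I. 0 \<le> u i" "sum u I = 1" "a \<in> I" "u a = 0"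
    "\<forall>q\<in>Q. (\<Sum>i\<in>I. u i * x i q) = z q"
proof (cases "\<exists>a\<in>I. w a = 0")
  case True
  then show ?thesis using that w z by blast
next
  case False
  then have pos: "\<forall>i\<in>I. 0 < w i" using w by (auto simp: less_le)
  obtain d0 where d0: "\<exists>i\<in>I. d0 i \<noteq> 0" "\<forall>q\<in>Q. (\<Sum>i\<in>I. d0 i * x i q) = 0"
    using homogeneous_system_nontrivial_solution[OF fin] by blast
  \<comment> \<open>The sign makes the total weight grow, or stay constant, in the direction of
    \<open>d\<close>.\<close>
  define d where "d = (if sum d0 I < 0 then (\<lambda>i. - d0 i) else d0)"
  have d: "\<exists>i\<in>I. d i \<noteq> 0" "\<forall>q\<in>Q. (\<Sum>i\<in>I. d i * x i q) = 0" "sum d I \<ge> 0"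
    using d0 by (auto simp: d_def sum_negf)
  have moved: "(\<Sum>i\<in>I. (w i + t * d i) * x i q) = z q" if "q \<in> Q" for t q
  proof -
    have "(\<Sum>i\<in>I. (w i + t * d i) * x i q) = (\<Sum>i\<in>I. w i * x i q) + t * (\<Sum>i\<in>I. d i * x i q)"
      by (simp add: algebra_simps sum.distrib sum_distrib_left)
    then show ?thesis using d that by (simp add: z)
  qed
  have sum_moved: "(\<Sum>i\<in>I. w i + t * d i) = 1 + t * sum d I" for t
    by (simp add: sum.distrib w flip: sum_distrib_left)
  \<comment> \<open>Otherwise the weights could be raised without limit; already the step of length
    1 leads to a point strictly closer to the origin than \<open>z\<close>.\<close>
  have "\<exists>i\<in>I. d i < 0"
  proof (rule ccontr)
    assume "\<not> ?thesis"
    then have dn: "\<forall>i\<in>I. 0 \<le> d i" by (auto simp: not_less)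
    have S: "sum d I > 0"
      using d(1) dn fin(2) by (metis less_eq_real_def sum_nonneg_eq_0_iff sum_nonneg)
    define u where "u i = (w i + 1 * d i) / (1 + sum d I)" for i
    have "\<forall>i\<in>I. 0 \<le> u i" using w dn S by (auto simp: u_def)
    moreover have "sum u I = 1"
      unfolding u_def sum_divide_distrib[symmetric] sum_moved using S by simp
    moreover have "(\<Sum>i\<in>I. u i * x i q) = z q / (1 + sum d I)" if "q \<in> Q" for q
      using moved[OF that, of 1] by (simp add: u_def flip: sum_divide_distrib)
    ultimately have "(\<Sum>q\<in>Q. (z q)\<^sup>2) \<le> (\<Sum>q\<in>Q. (z q / (1 + sum d I))\<^sup>2)"
      using min[of u] by simp
    also have "\<dots> = (\<Sum>q\<in>Q. (z q)\<^sup>2) / (1 + sum d I)\<^sup>2"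
      by (simp add: power_divide sum_divide_distrib)
    also have "\<dots> < (\<Sum>q\<in>Q. (z q)\<^sup>2)"
      using nz S by (simp add: divide_less_eq power2_eq_square algebra_simps)
        (smt (verit) mult_pos_pos)
    finally show False by simp
  qed
  define N where "N = {i\<in>I. d i < 0}"
  have N: "finite N" "N \<noteq> {}" using fin \<open>\<exists>i\<in>I. d i < 0\<close> by (auto simp: N_def)
  \<comment> \<open>The longest step along \<open>d\<close> that keeps all weights nonnegative; at
    its end the weight of some \<open>a\<close> has become 0.\<close>
  define t where "t = Min ((\<lambda>i. w i / - d i) ` N)"
  obtain a where a: "a \<in> N" "t = w a / - d a"
    using Min_in[of "(\<lambda>i. w i / - d i) ` N"] N unfolding t_def by blast
  have tpos: "t > 0" using a pos by (auto simp: N_def divide_pos_neg)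
  have tle: "t \<le> w i / - d i" if "i \<in> N" for i
    unfolding t_def using N that by auto
  have nn: "0 \<le> w i + t * d i" if "i \<in> I" for i
  proof (cases "i \<in> N")
    case True
    then show ?thesis using tle[OF True] by (simp add: N_def field_simps)
  next
    case False
    then show ?thesis using that w tpos by (simp add: N_def)
  qed
  define S where "S = 1 + t * sum d I"
  have S1: "S \<ge> 1" using tpos d(3) by (simp add: S_def)
  define u where "u i = (w i + t * d i) / S" for i
  have u: "\<forall>i\<in>I. 0 \<le> u i" using nn S1 by (auto simp: u_def)
  have u1: "sum u I = 1"
    unfolding u_def sum_divide_distrib[symmetric] sum_moved using S1 by (simp add: S_def)
  have uz: "(\<Sum>i\<in>I. u i * x i q) = z q / S" if "q \<in> Q" for q
    using moved[OF that, of t] by (simp add: u_def flip: sum_divide_distrib)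
  have "(\<Sum>q\<in>Q. (z q)\<^sup>2) \<le> (\<Sum>q\<in>Q. (z q / S)\<^sup>2)"
    using min[OF u u1] uz by simp
  also have "\<dots> = (\<Sum>q\<in>Q. (z q)\<^sup>2) / S\<^sup>2"
    by (simp add: power_divide sum_divide_distrib)
  finally have "S\<^sup>2 \<le> 1"
    using nz S1 by (simp add: le_divide_eq)
  then have "S = 1" using S1 by (smt (verit) power2_eq_square mult_less_cancel_left2)
  moreover have "u a = 0" using a by (auto simp: u_def N_def)
  moreover have "a \<in> I" using a by (simp add: N_def)
  ultimately show ?thesis using that[of u a] u u1 uz by simp
qed

text \<open>Barany's argument: among all colourful simplices take the one closest to the origin.
  If it misses the origin, its nearest point does not need one of the colours, and swapping in
  a point of that colour from the far side of the origin moves the simplex closer.\<close>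

theorem colourful_caratheodory:
  fixes c :: "'i \<Rightarrow> 'j \<Rightarrow> 'q \<Rightarrow> real"
  assumes fin: "finite Q" "finite I" "card Q < card I" "finite J"
    and \<mu>: "\<And>i j. i \<in> I \<Longrightarrow> j \<in> J \<Longrightarrow> 0 \<le> \<mu> i j" "\<And>i. i \<in> I \<Longrightarrow> sum (\<mu> i) J = 1"
    and zero: "\<And>i q. i \<in> I \<Longrightarrow> q \<in> Q \<Longrightarrow> (\<Sum>j\<in>J. \<mu> i j * c i j q) = 0"
  obtains s w where "\<forall>i\<in>I. s i \<in> J" "\<forall>i\<in>I. 0 \<le> w i" "sum w I = 1"
    "\<forall>q\<in>Q. (\<Sum>i\<in>I. w i * c i (s i) q) = 0"
proof -
  define f where "f s w = (\<Sum>q\<in>Q. (\<Sum>i\<in>I. w i * c i (s i) q)\<^sup>2)" for s w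
  define T where "T = PiE I (\<lambda>_. J)"
  have "I \<noteq> {}" using fin by auto
  have "J \<noteq> {}" using \<mu>(2) \<open>I \<noteq> {}\<close> by fastforce
  have T: "finite T" "T \<noteq> {}"
    using fin \<open>J \<noteq> {}\<close> by (auto simp: T_def finite_PiE PiE_eq_empty_iff)
  have "\<exists>w. (\<forall>i\<in>I. 0 \<le> w i) \<and> sum w I = 1 \<and>
    (\<forall>u. (\<forall>i\<in>I. 0 \<le> u i) \<and> sum u I = 1 \<longrightarrow> f s w \<le> f s u)" for s
  proof -
    have "continuous_on UNIV (f s)"
      unfolding f_def by (intro continuous_intros continuous_on_product_coordinates)
    then obtain w where w: "\<forall>i\<in>I. 0 \<le> w i" "sum w I = 1"
      "\<And>u. (\<forall>i\<in>I. 0 \<le> u i) \<Longrightarrow> sum u I = 1 \<Longrightarrow> (\<forall>i. i \<notin> I \<longrightarrow> u i = 0) \<Longrightarrow> f s w \<le> f s u"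
      using simplex_minimum[OF fin(2) \<open>I \<noteq> {}\<close>] by blast
    \<comment> \<open>\<open>f s\<close> reads weights on \<open>I\<close> only, so a competitor may
      be cut off to 0 elsewhere.\<close>
    have "f s w \<le> f s u" if "\<forall>i\<in>I. 0 \<le> u i" "sum u I = 1" for u
    proof -
      have "f s w \<le> f s (\<lambda>i. if i \<in> I then u i else 0)"
        by (rule w) (use that in \<open>auto cong: sum.cong\<close>)
      also have "\<dots> = f s u" by (simp add: f_def cong: sum.cong)
      finally show ?thesis .
    qed
    then show ?thesis using w by blast
  qed
  then obtain W where W: "\<And>s. \<forall>i\<in>I. 0 \<le> W s i" "\<And>s. sum (W s) I = 1"
    "\<And>s u. (\<forall>i\<in>I. 0 \<le> u i) \<Longrightarrow> sum u I = 1 \<Longrightarrow> f s (W s) \<le> f s u"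
    by metis
  obtain s where s: "s \<in> T" "\<And>s'. s' \<in> T \<Longrightarrow> f s (W s) \<le> f s' (W s')"
    using T arg_min_least[of T _ "\<lambda>s. f s (W s)"] arg_min_if_finite(1)[of T "\<lambda>s. f s (W s)"] by blast
  define z where "z = (\<lambda>q. \<Sum>i\<in>I. W s i * c i (s i) q)"
  define Z where "Z = (\<Sum>q\<in>Q. (z q)\<^sup>2)"
  have Zf: "Z = f s (W s)" by (simp add: Z_def z_def f_def)
  have "Z \<ge> 0" by (simp add: Z_def sum_nonneg)
  have "\<not> Z > 0"
  proof
    assume "Z > 0"
    obtain u a where u: "\<forall>i\<in>I. 0 \<le> u i" "sum u I = 1" "a \<in> I" "u a = 0"
      "\<forall>q\<in>Q. (\<Sum>i\<in>I. u i * c i (s i) q) = z q"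
    proof (rule convex_combination_avoiding_index[OF fin(1-3) W(1)[of s] W(2)[of s], of z "\<lambda>i. c i (s i)"])
      show "z = (\<lambda>q. \<Sum>i\<in>I. W s i * c i (s i) q)" by (simp add: z_def)
      show "(\<Sum>q\<in>Q. (z q)\<^sup>2) > 0" using \<open>Z > 0\<close> by (simp add: Z_def)
      show "(\<Sum>q\<in>Q. (z q)\<^sup>2) \<le> (\<Sum>q\<in>Q. (\<Sum>i\<in>I. u i * c i (s i) q)\<^sup>2)"
        if "\<forall>i\<in>I. 0 \<le> u i" "sum u I = 1" for u
        using W(3)[OF that, of s] Zf by (simp add: Z_def f_def)
    qed blast
    \<comment> \<open>The inner products of colour \<open>a\<close> with \<open>z\<close> average to
      0 under \<open>\<mu> a\<close>, so they cannot all be positive.\<close>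
    have "\<exists>j\<in>J. (\<Sum>q\<in>Q. c a j q * z q) \<le> 0"
    proof (rule ccontr)
      assume "\<not> ?thesis"
      then have pos: "\<forall>j\<in>J. (\<Sum>q\<in>Q. c a j q * z q) > 0" by (auto simp: not_le)
      have "(\<Sum>j\<in>J. \<mu> a j * (\<Sum>q\<in>Q. c a j q * z q)) = (\<Sum>q\<in>Q. (\<Sum>j\<in>J. \<mu> a j * c a j q) * z q)"
        unfolding sum_distrib_left sum_distrib_right by (subst sum.swap) (simp add: mult.assoc)
      also have "\<dots> = 0" using zero u(3) by simp
      finally have "\<forall>j\<in>J. \<mu> a j * (\<Sum>q\<in>Q. c a j q * z q) = 0"
        using \<mu>(1) u(3) pos fin(4) by (subst (asm) sum_nonneg_eq_0_iff) (auto simp: less_imp_le)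
      then have "\<forall>j\<in>J. \<mu> a j = 0" using pos by fastforce
      then show False using \<mu>(2)[OF u(3)] by simp
    qed
    then obtain j where j: "j \<in> J" "(\<Sum>q\<in>Q. c a j q * z q) \<le> 0" by blast
    define Y where "Y = (\<Sum>q\<in>Q. (c a j q)\<^sup>2)"
    have "Y \<ge> 0" by (simp add: Y_def sum_nonneg)
    \<comment> \<open>This value minimises \<open>(1 - e)\<^sup>2 * Z + e\<^sup>2 * Y\<close>, the
      bound below for the squared distance after moving from \<open>z\<close> towards
      \<open>c a j\<close>.\<close>
    define e where "e = Z / (Z + Y)"
    have e: "0 < e" "e \<le> 1" using \<open>Z > 0\<close> \<open>Y \<ge> 0\<close> by (auto simp: e_def)
    define s' where "s' = s(a := j)"
    have "s' \<in> T" using s(1) j u(3) by (auto simp: T_def s'_def PiE_iff extensional_def)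
    \<comment> \<open>Since \<open>u a = 0\<close>, exchanging the point of colour \<open>a\<close>
      leaves \<open>z\<close> in the new simplex, and \<open>u'\<close> moves from \<open>z\<close>
      a fraction \<open>e\<close> of the way to the new vertex.\<close>
    define u' where "u' i = (1 - e) * u i + (if i = a then e else 0)" for i
    have "f s (W s) \<le> f s' (W s')" using s \<open>s' \<in> T\<close> by blast
    also have "\<dots> \<le> f s' u'"
    proof (rule W(3))
      show "\<forall>i\<in>I. 0 \<le> u' i" using u e by (auto simp: u'_def)
      show "sum u' I = 1"
        using u fin(2) by (simp add: u'_def sum.distrib flip: sum_distrib_left)
    qed
    also have "f s' u' = (\<Sum>q\<in>Q. ((1 - e) * z q + e * c a j q)\<^sup>2)"
      unfolding f_def
    proof (intro sum.cong refl arg_cong[of _ _ "\<lambda>t. t\<^sup>2"])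
      fix q assume q: "q \<in> Q"
      have "(\<Sum>i\<in>I. u' i * c i (s' i) q)
        = (\<Sum>i\<in>I. (1 - e) * (u i * c i (s i) q) + (if i = a then e * c a j q else 0))"
        using u(4) by (intro sum.cong) (auto simp: u'_def s'_def)
      also have "\<dots> = (1 - e) * z q + e * c a j q"
        using u(3,5) q fin(2) by (simp add: sum.distrib flip: sum_distrib_left)
      finally show "(\<Sum>i\<in>I. u' i * c i (s' i) q) = (1 - e) * z q + e * c a j q" .
    qed
    also have "\<dots> = (1 - e)\<^sup>2 * Z + 2 * e * (1 - e) * (\<Sum>q\<in>Q. c a j q * z q) + e\<^sup>2 * Y"
      unfolding Z_def Y_def sum_distrib_left sum.distrib[symmetric]
      by (intro sum.cong) (auto simp: power2_eq_square algebra_simps)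
    also have "\<dots> \<le> (1 - e)\<^sup>2 * Z + e\<^sup>2 * Y"
      using e j(2) by (simp add: mult_nonneg_nonpos)
    also have "\<dots> = Z - e * (2 * Z - e * (Z + Y))"
      by (simp add: power2_eq_square algebra_simps)
    also have "e * (Z + Y) = Z" using \<open>Z > 0\<close> \<open>Y \<ge> 0\<close> by (simp add: e_def)
    also have "Z - e * (2 * Z - Z) < Z" using e \<open>Z > 0\<close> by simp
    finally show False by (simp add: Zf)
  qed
  then have "Z = 0" using \<open>Z \<ge> 0\<close> by simp
  then have "\<forall>q\<in>Q. z q = 0"
    using fin(1) unfolding Z_def by (subst (asm) sum_nonneg_eq_0_iff) auto
  then show thesis
    using that[of s "W s"] s(1) W by (auto simp: T_def z_def)
qed

text \<open>Sarkaria's lifting: each point is homogenised and tensored with the \<open>r\<close> vectors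
  \<open>e\<^sub>0, \<dots>, e\<^bsub>r-2\<^esub>, -(e\<^sub>0 + \<dots> + e\<^bsub>r-2\<^esub>)\<close>, whose only linear dependences are the constant ones.\<close>

theorem tverberg:
  fixes x :: "'i \<Rightarrow> 'q \<Rightarrow> real"
  assumes "finite Q" "finite I" "1 \<le> r" "card I = (r - 1) * (card Q + 1) + 1"
  obtains s w y where "\<forall>i\<in>I. s i < r" "\<forall>i\<in>I. 0 \<le> w i"
    "\<And>j. j < r \<Longrightarrow> (\<Sum>i\<in>{i\<in>I. s i = j}. w i) = 1"
    "\<And>j q. j < r \<Longrightarrow> q \<in> Q \<Longrightarrow> (\<Sum>i\<in>{i\<in>I. s i = j}. w i * x i q) = y q"
proof -
  define h where "h i m = (case m of None \<Rightarrow> 1 | Some q \<Rightarrow> x i q)" for i m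
  \<comment> \<open>The lifted space has one coordinate fewer than there are points, which is just
    what the colourful theorem demands.\<close>
  define R where "R = {..<r - 1} \<times> insert None (Some ` Q)"
  define e where "e j l = (if j < r - 1 then (if l = j then 1 else 0) else - 1 :: real)" for j l :: nat
  define c where "c i j p = e j (fst p) * h i (snd p)" for i j p
  have "finite R" using assms by (simp add: R_def)
  have "card R = (r - 1) * (card Q + 1)"
    using assms(1) by (simp add: R_def card_cartesian_product card_image image_iff)
  then have "card R < card I" using assms by simp
  have r: "{..<r} = insert (r - 1) {..<r - 1}" using assms(3) by auto
  have e0: "(\<Sum>j<r. e j l) = 0" if "l < r - 1" for l
    using that by (subst r) (simp add: e_def)
  \<comment> \<open>Colour \<open>i\<close> consists of the \<open>r\<close> lifts of point
    \<open>i\<close>. They sum to 0, so equal weights put the origin in each hull. The lift selected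
    for \<open>i\<close> names the part that receives \<open>i\<close>.\<close>
  obtain s w where s: "\<forall>i\<in>I. s i \<in> {..<r}" and w: "\<forall>i\<in>I. 0 \<le> w i" "sum w I = 1"
    and z: "\<forall>p\<in>R. (\<Sum>i\<in>I. w i * c i (s i) p) = 0"
  proof (rule colourful_caratheodory[OF \<open>finite R\<close> assms(2) \<open>card R < card I\<close>,
        of "{..<r}" "\<lambda>_ _. 1 / real r" c])
    show "(\<Sum>j<r. 1 / real r * c i j q) = 0" if "i \<in> I" "q \<in> R" for i q
    proof -
      have "(\<Sum>j<r. 1 / real r * c i j q) = 1 / real r * ((\<Sum>j<r. e j (fst q)) * h i (snd q))"
        unfolding c_def sum_distrib_left sum_distrib_right by simp
      then show ?thesis using e0 that by (auto simp: R_def)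
    qed
  qed (use assms(3) in auto)
  define Y where "Y j m = (\<Sum>i\<in>{i\<in>I. s i = j}. w i * h i m)" for j m
  have group: "(\<Sum>i\<in>I. g i) = (\<Sum>j<r. \<Sum>i\<in>{i\<in>I. s i = j}. g i)" for g :: "'i \<Rightarrow> real"
    using sum.group[of I "{..<r}" s g] assms(2) s by (auto simp: image_subset_iff)
  \<comment> \<open>Block \<open>l\<close> of the vanishing combination reads
    \<open>Y l - Y (r - 1) = 0\<close>: part \<open>l\<close> contributes with sign 1, the last part
    with sign -1, all others with 0.\<close>
  have Yeq: "Y l m = Y (r - 1) m" if "l < r" "m \<in> insert None (Some ` Q)" for l m
  proof (cases "l < r - 1")
    case True
    then have "(l, m) \<in> R" using that by (simp add: R_def)
    then have "0 = (\<Sum>i\<in>I. w i * c i (s i) (l, m))" using z by simp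
    also have "\<dots> = (\<Sum>j<r. e j l * Y j m)"
      unfolding Y_def sum_distrib_left
      by (subst group) (intro sum.cong, auto simp: c_def)
    also have "\<dots> = Y l m - Y (r - 1) m"
    proof -
      have "(\<Sum>j<r - 1. e j l * Y j m) = (\<Sum>j<r - 1. if j = l then Y j m else 0)"
        by (intro sum.cong) (auto simp: e_def)
      then show ?thesis using True by (subst r) (simp add: e_def)
    qed
    finally show ?thesis by simp
  next
    case False
    then have "l = r - 1" using that by simp
    then show ?thesis by simp
  qed
  \<comment> \<open>The homogenising coordinate adds up weights, so each part weighs
    \<open>1 / r\<close>; hence the factor \<open>real r\<close> in the witnesses.\<close>
  have "1 = (\<Sum>j<r. Y j None)" unfolding Y_def w(2)[symmetric] by (subst group) (simp add: h_def)
  also have "\<dots> = (\<Sum>j<r. Y (r - 1) None)" by (intro sum.cong refl Yeq) auto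
  also have "\<dots> = real r * Y (r - 1) None" by simp
  finally have rY: "real r * Y (r - 1) None = 1" by simp
  show thesis
  proof (rule that[of s "\<lambda>i. real r * w i" "\<lambda>q. real r * Y (r - 1) (Some q)"])
    show "(\<Sum>i\<in>{i\<in>I. s i = j}. real r * w i) = 1" if "j < r" for j
      using Yeq[OF that, of None] rY by (simp add: Y_def h_def flip: sum_distrib_left)
    show "(\<Sum>i\<in>{i\<in>I. s i = j}. real r * w i * x i q) = real r * Y (r - 1) (Some q)"
      if "j < r" "q \<in> Q" for j q
      using Yeq[OF that(1), of "Some q"] that(2)
      by (simp add: Y_def h_def mult.assoc flip: sum_distrib_left)
  qed (use s w in auto)
qed

section \<open>The Brunn--Minkowski inequality\<close>

definition minkowski_mix :: "real \<Rightarrow> 'a::real_vector set \<Rightarrow> 'a set \<Rightarrow> 'a set" where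
  "minkowski_mix t A B = {(1 - t) *\<^sub>R x + t *\<^sub>R y | x y. x \<in> A \<and> y \<in> B}"

lemma minkowski_mix_mono: "A \<subseteq> A' \<Longrightarrow> B \<subseteq> B' \<Longrightarrow> minkowski_mix t A B \<subseteq> minkowski_mix t A' B'"
  by (auto simp: minkowski_mix_def)

lemma minkowski_mix_swap: "minkowski_mix t A B = minkowski_mix (1 - t) B A"
  by (auto simp: minkowski_mix_def) (metis add.commute)+

lemma minkowski_mix_eq_sums:
  "minkowski_mix t A B = (\<Union>x\<in>(*\<^sub>R) (1 - t) ` A. \<Union>y\<in>(*\<^sub>R) t ` B. {x + y})"
  by (auto simp: minkowski_mix_def)

text \<open>Minkowski sums of measurable sets can fail to be measurable. With
  \<open>t \<noteq> 1\<close> the openness of \<open>A\<close> passes to the mix.\<close>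

lemma lmeasurable_minkowski_mix:
  fixes A B :: "'a::euclidean_space set"
  assumes "open A" "bounded A" "bounded B" "t \<noteq> 1"
  shows "minkowski_mix t A B \<in> lmeasurable"
  unfolding minkowski_mix_eq_sums
  using assms by (intro lmeasurable_open bounded_sums bounded_scaling open_sums disjI1 open_scaling) auto

section \<open>Finite families of disjoint open boxes\<close>

lemma box_Int_halfspace:
  fixes a b :: "'a::euclidean_space"
  assumes "k \<in> Basis"
  shows "box a b \<inter> {x. x \<bullet> k < c} = box a (\<Sum>i\<in>Basis. (if i = k then min (b \<bullet> k) c else b \<bullet> i) *\<^sub>R i)"
    and "box a b \<inter> {x. c < x \<bullet> k} = box (\<Sum>i\<in>Basis. (if i = k then max (a \<bullet> k) c else a \<bullet> i) *\<^sub>R i) b"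
  using assms by (rule_tac set_eqI; auto simp: mem_box)+

text \<open>Open boxes stay open boxes when cut by an open coordinate halfspace. Excluding the empty
  box gives every member positive volume and makes the cardinality a usable induction
  measure.\<close>

definition disjoint_boxes :: "'a::euclidean_space set set \<Rightarrow> bool" where
  "disjoint_boxes F \<longleftrightarrow> finite F \<and> disjoint F \<and> (\<forall>K\<in>F. K \<noteq> {} \<and> (\<exists>a b. K = box a b))"

lemma disjoint_boxes_Union:
  assumes "disjoint_boxes F"
  shows "open (\<Union>F)" "bounded (\<Union>F)" "\<Union>F \<in> lmeasurable"
proof -
  show *: "open (\<Union>F)" "bounded (\<Union>F)"
    using assms by (force simp: disjoint_boxes_def open_box intro!: open_Union bounded_Union bounded_box)+
  then show "\<Union>F \<in> lmeasurable" by (simp add: lmeasurable_open)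
qed

lemma disjoint_boxes_measure_pos:
  assumes "disjoint_boxes F" "F \<noteq> {}"
  shows "0 < measure lebesgue (\<Union>F)"
proof -
  have "\<Union>F \<noteq> {}" using assms by (auto simp: disjoint_boxes_def)
  then have "\<not> negligible (\<Union>F)"
    using disjoint_boxes_Union[OF assms(1)] open_not_negligible by blast
  then show ?thesis
    using disjoint_boxes_Union(3)[OF assms(1)] by (simp add: negligible_iff_measure zero_less_measure_iff)
qed

text \<open>\<open>H\<close> stands for either side of a coordinate hyperplane. The last claim
  drives the later induction: a box missing \<open>H\<close> disappears, so the count drops.\<close>

lemma disjoint_boxes_Int:
  fixes H :: "'a::euclidean_space set"
  assumes F: "disjoint_boxes F" and H: "\<And>a b. \<exists>a' b'. box a b \<inter> H = box a' b'"
  defines "F' \<equiv> (\<lambda>K. K \<inter> H) ` F - {{}}"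
  shows "disjoint_boxes F'" "\<Union>F' = \<Union>F \<inter> H" "card F' \<le> card F"
    "K \<in> F \<Longrightarrow> K \<inter> H = {} \<Longrightarrow> card F' < card F"
proof -
  have fin: "finite F" using F by (simp add: disjoint_boxes_def)
  have "\<exists>a b. K \<inter> H = box a b" if "K \<in> F" for K
    using F H that by (metis disjoint_boxes_def)
  then show "disjoint_boxes F'"
    using F by (fastforce simp: disjoint_boxes_def F'_def disjoint_def)
  show "\<Union>F' = \<Union>F \<inter> H" by (auto simp: F'_def)
  show "card F' \<le> card F"
    unfolding F'_def by (meson Diff_subset card_image_le card_mono fin finite_imageI le_trans)
  assume "K \<in> F" "K \<inter> H = {}"
  then have "F' \<subseteq> (\<lambda>K. K \<inter> H) ` (F - {K})" by (auto simp: F'_def)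
  then have "card F' \<le> card (F - {K})"
    by (meson card_image_le card_mono fin finite_Diff finite_imageI le_trans)
  also have "\<dots> < card F" using \<open>K \<in> F\<close> fin by (rule card_Diff1_less[rotated])
  finally show "card F' < card F" .
qed

section \<open>Cutting volume by coordinate hyperplanes\<close>

lemma measure_split_hyperplane:
  fixes A :: "'a::euclidean_space set"
  assumes "A \<in> lmeasurable" "k \<in> Basis"
  shows "measure lebesgue A = measure lebesgue (A \<inter> {x. x \<bullet> k < c}) + measure lebesgue (A \<inter> {x. c < x \<bullet> k})"
proof -
  let ?L = "A \<inter> {x. x \<bullet> k < c}" and ?R = "A \<inter> {x. c < x \<bullet> k}"
  have "open {x. x \<bullet> k < c}" "open {x. c < x \<bullet> k}"
    by (auto simp: inner_commute[of _ k] open_halfspace_lt open_halfspace_gt)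
  then have LR: "?L \<in> lmeasurable" "?R \<in> lmeasurable"
    using assms(1) by (auto intro!: fmeasurable_Int_fmeasurable borel_open)
  have "measure lebesgue A = measure lebesgue (?L \<union> ?R)"
  proof (rule measure_negligible_symdiff)
    show "negligible (?L \<union> ?R - A \<union> (A - (?L \<union> ?R)))"
      by (rule negligible_subset[OF negligible_standard_hyperplane[OF assms(2), of c]]) auto
  qed (use LR in auto)
  also have "\<dots> = measure lebesgue ?L + measure lebesgue ?R"
  proof -
    have "?L \<inter> ?R = {}" by auto
    then show ?thesis using measure_Un3[OF LR] by simp
  qed
  finally show ?thesis .
qed

text \<open>Moving the hyperplane sweeps out a slab of a box around \<open>B\<close>. Its volume is
  at most the distance times the cross-section \<open>L\<close> of that box, so the volume is
  Lipschitz in \<open>c\<close>.\<close>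

lemma continuous_on_measure_halfspace:
  fixes B :: "'a::euclidean_space set"
  assumes B: "B \<in> lmeasurable" "bounded B" and k: "k \<in> Basis"
  shows "continuous_on UNIV (\<lambda>c. measure lebesgue (B \<inter> {x. x \<bullet> k < c}))"
proof -
  let ?g = "\<lambda>c. measure lebesgue (B \<inter> {x. x \<bullet> k < c})"
  obtain m where m: "B \<subseteq> cbox (- m) m" using B(2) bounded_subset_cbox_symmetric by blast
  define L where "L = (\<Prod>i\<in>Basis - {k}. 2 * \<bar>m \<bullet> i\<bar>)"
  have "L \<ge> 0" by (auto simp: L_def intro: prod_nonneg)
  have meas: "B \<inter> {x. x \<bullet> k < c} \<in> lmeasurable" for c
    using B(1) open_halfspace_lt[of k c] by (auto intro!: fmeasurable_Int_fmeasurable borel_open simp: inner_commute[of _ k])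
  have lip: "\<bar>?g c' - ?g c\<bar> \<le> L * \<bar>c' - c\<bar>" if "c \<le> c'" for c c'
  proof -
    let ?l = "\<Sum>i\<in>Basis. (if i = k then c else - m \<bullet> i) *\<^sub>R i"
    let ?u = "\<Sum>i\<in>Basis. (if i = k then c' else m \<bullet> i) *\<^sub>R i"
    have "?g c \<le> ?g c'"
      by (rule measure_mono_fmeasurable) (use that meas in auto)
    moreover have "?g c' \<le> measure lebesgue ((B \<inter> {x. x \<bullet> k < c}) \<union> cbox ?l ?u)"
    proof (rule measure_mono_fmeasurable)
      show "B \<inter> {x. x \<bullet> k < c'} \<subseteq> (B \<inter> {x. x \<bullet> k < c}) \<union> cbox ?l ?u"
      proof
        fix x assume x: "x \<in> B \<inter> {x. x \<bullet> k < c'}"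
        then have "\<forall>i\<in>Basis. - (m \<bullet> i) \<le> x \<bullet> i \<and> x \<bullet> i \<le> m \<bullet> i"
          using m by (auto simp: mem_box subset_iff)
        then show "x \<in> (B \<inter> {x. x \<bullet> k < c}) \<union> cbox ?l ?u"
          using x by (auto simp: mem_box)
      qed
    qed (use meas in auto)
    moreover have "\<dots> \<le> ?g c + measure lebesgue (cbox ?l ?u)"
      by (rule measure_Un_le) (use meas in auto)
    moreover have "measure lebesgue (cbox ?l ?u) \<le> L * (c' - c)"
    proof (cases "cbox ?l ?u = {}")
      case True
      then show ?thesis using that \<open>L \<ge> 0\<close> by simp
    next
      case False
      then have "\<forall>i\<in>Basis. ?l \<bullet> i \<le> ?u \<bullet> i" by (simp add: box_ne_empty)
      have "measure lebesgue (cbox ?l ?u) = (\<Prod>i\<in>Basis. ?u \<bullet> i - ?l \<bullet> i)"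
        using False content_cbox_if[of ?l ?u] by simp
      also have "\<dots> = (c' - c) * (\<Prod>i\<in>Basis - {k}. ?u \<bullet> i - ?l \<bullet> i)"
        using k by (simp add: prod.remove[of Basis k])
      also have "\<dots> \<le> (c' - c) * L"
        unfolding L_def
        by (intro mult_left_mono prod_mono) (use that \<open>\<forall>i\<in>Basis. ?l \<bullet> i \<le> ?u \<bullet> i\<close> in auto)
      finally show ?thesis by (simp add: mult.commute)
    qed
    ultimately show ?thesis using that by simp
  qed
  have "L-lipschitz_on UNIV ?g"
  proof (rule lipschitz_onI)
    show "dist (?g x) (?g y) \<le> L * dist x y" for x y
      using lip[of x y] lip[of y x] by (cases "x \<le> y") (auto simp: dist_real_def abs_minus_commute)
  qed fact
  then show ?thesis by (rule lipschitz_on_continuous_on)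
qed

lemma halfspace_with_given_measure:
  fixes B :: "'a::euclidean_space set"
  assumes B: "B \<in> lmeasurable" "bounded B" and k: "k \<in> Basis"
    and m: "0 \<le> m" "m \<le> measure lebesgue B"
  obtains c where "measure lebesgue (B \<inter> {x. x \<bullet> k < c}) = m"
proof -
  let ?g = "\<lambda>c. measure lebesgue (B \<inter> {x. x \<bullet> k < c})"
  obtain M where M: "\<And>x. x \<in> B \<Longrightarrow> norm x \<le> M" using B(2) bounded_iff by blast
  have *: "\<bar>x \<bullet> k\<bar> \<le> \<bar>M\<bar>" if "x \<in> B" for x
    using M[OF that] Basis_le_norm[OF k, of x] by linarith
  have "B \<inter> {x. x \<bullet> k < - \<bar>M\<bar>} = {}" using * by fastforce
  moreover have "B \<inter> {x. x \<bullet> k < \<bar>M\<bar> + 1} = B" using * by fastforce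
  ultimately have "\<exists>c\<ge>- \<bar>M\<bar>. c \<le> \<bar>M\<bar> + 1 \<and> ?g c = m"
    using m continuous_on_subset[OF continuous_on_measure_halfspace[OF B k]]
    by (intro IVT') auto
  then show thesis using that by blast
qed

section \<open>The inequality for unions of boxes\<close>

text \<open>In each coordinate \<open>z\<close> divides the mixed side in some ratio
  \<open>l i\<close>; the points dividing the sides of both boxes in these same ratios mix to
  \<open>z\<close>.\<close>

lemma box_subset_minkowski_mix:
  fixes a b c d :: "'a::euclidean_space"
  assumes "box a b \<noteq> {}" "box c d \<noteq> {}" "0 \<le> t" "t \<le> 1"
  shows "box ((1 - t) *\<^sub>R a + t *\<^sub>R c) ((1 - t) *\<^sub>R b + t *\<^sub>R d) \<subseteq> minkowski_mix t (box a b) (box c d)"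
proof
  fix z assume z: "z \<in> box ((1 - t) *\<^sub>R a + t *\<^sub>R c) ((1 - t) *\<^sub>R b + t *\<^sub>R d)"
  define p where "p i = (1 - t) * (a \<bullet> i) + t * (c \<bullet> i)" for i
  define q where "q i = (1 - t) * (b \<bullet> i) + t * (d \<bullet> i)" for i
  define l where "l i = (z \<bullet> i - p i) / (q i - p i)" for i
  have pq: "p i < z \<bullet> i" "z \<bullet> i < q i" if "i \<in> Basis" for i
    using z that by (auto simp: mem_box p_def q_def inner_add_left)
  have l: "0 < l i" "l i < 1" if "i \<in> Basis" for i
    using pq[OF that] by (auto simp: l_def)
  define x where "x = (\<Sum>i\<in>Basis. (a \<bullet> i + l i * (b \<bullet> i - a \<bullet> i)) *\<^sub>R i)"
  define y where "y = (\<Sum>i\<in>Basis. (c \<bullet> i + l i * (d \<bullet> i - c \<bullet> i)) *\<^sub>R i)"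
  have between: "u < u + s * (v - u)" "u + s * (v - u) < v" if "0 < s" "s < 1" "u < v" for s u v :: real
  proof -
    show "u < u + s * (v - u)" using that by simp
    have "s * (v - u) < 1 * (v - u)" using that by (intro mult_strict_right_mono) auto
    then show "u + s * (v - u) < v" by simp
  qed
  have "x \<in> box a b" "y \<in> box c d"
    using assms(1,2) l between by (auto simp: mem_box x_def y_def box_ne_empty)
  moreover have "z = (1 - t) *\<^sub>R x + t *\<^sub>R y"
  proof (rule euclidean_eqI)
    fix i :: 'a assume i: "i \<in> Basis"
    have "((1 - t) *\<^sub>R x + t *\<^sub>R y) \<bullet> i = p i + l i * (q i - p i)"
      using i by (simp add: x_def y_def p_def q_def inner_add_left) (simp add: algebra_simps)
    also have "\<dots> = z \<bullet> i" using pq[OF i] by (simp add: l_def)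
    finally show "z \<bullet> i = ((1 - t) *\<^sub>R x + t *\<^sub>R y) \<bullet> i" by simp
  qed
  ultimately show "z \<in> minkowski_mix t (box a b) (box c d)"
    by (auto simp: minkowski_mix_def)
qed

text \<open>Volumes are products of side lengths, and sides mix linearly: weighted AM-GM in each
  coordinate.\<close>

lemma brunn_minkowski_box:
  fixes a b c d :: "'a::euclidean_space"
  assumes "box a b \<noteq> {}" "box c d \<noteq> {}" "0 < t" "t < 1"
  shows "measure lebesgue (box a b) powr (1 - t) * measure lebesgue (box c d) powr t
    \<le> measure lebesgue (minkowski_mix t (box a b) (box c d))"
proof -
  let ?p = "(1 - t) *\<^sub>R a + t *\<^sub>R c" and ?q = "(1 - t) *\<^sub>R b + t *\<^sub>R d"
  have lt: "\<forall>i\<in>Basis. a \<bullet> i < b \<bullet> i" "\<forall>i\<in>Basis. c \<bullet> i < d \<bullet> i"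
    using assms by (auto simp: box_ne_empty)
  have box: "measure lebesgue (box u v) = (\<Prod>i\<in>Basis. (v - u) \<bullet> i)"
    if "\<forall>i\<in>Basis. u \<bullet> i < v \<bullet> i" for u v :: 'a
    using that by (simp add: measure_lborel_box_eq less_imp_le)
  have pq: "\<forall>i\<in>Basis. ?p \<bullet> i < ?q \<bullet> i"
    using lt assms by (auto simp: inner_add_left intro!: add_strict_mono)
  have "measure lebesgue (box a b) powr (1 - t) * measure lebesgue (box c d) powr t
    = (\<Prod>i\<in>Basis. ((b - a) \<bullet> i) powr (1 - t) * ((d - c) \<bullet> i) powr t)"
    by (simp only: box[OF lt(1)] box[OF lt(2)] prod_powr_distrib prod.distrib)
  also have "\<dots> \<le> (\<Prod>i\<in>Basis. (?q - ?p) \<bullet> i)"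
  proof (rule prod_mono, intro conjI)
    fix i :: 'a assume i: "i \<in> Basis"
    have "((b - a) \<bullet> i) powr (1 - t) * ((d - c) \<bullet> i) powr t \<le> (1 - t) * ((b - a) \<bullet> i) + t * ((d - c) \<bullet> i)"
      using assms lt i by (intro Youngs_inequality_0) (auto simp: inner_diff_left)
    also have "\<dots> = (?q - ?p) \<bullet> i" by (simp add: inner_diff_left inner_add_left algebra_simps)
    finally show "((b - a) \<bullet> i) powr (1 - t) * ((d - c) \<bullet> i) powr t \<le> (?q - ?p) \<bullet> i" .
  qed auto
  also have "\<dots> = measure lebesgue (box ?p ?q)" by (simp only: box[OF pq])
  also have "\<dots> \<le> measure lebesgue (minkowski_mix t (box a b) (box c d))"
    using assms
    by (intro measure_mono_fmeasurable box_subset_minkowski_mix lmeasurable_minkowski_mix) (auto simp: bounded_box open_box)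
  finally show ?thesis .
qed

text \<open>Hadwiger and Ohmann's induction. A coordinate hyperplane separates two boxes of \<open>F\<close>; a parallel
  one divides the volume of \<open>G\<close> in the same ratio. The mixes of corresponding halves are disjoint,
  and both halves of \<open>F\<close> consist of fewer boxes.\<close>

lemma brunn_minkowski_split:
  fixes F G :: "'a::euclidean_space set set"
  assumes F: "disjoint_boxes F" "2 \<le> card F" and G: "disjoint_boxes G" "G \<noteq> {}"
    and t: "0 < t" "t < 1"
    and IH: "\<And>F' G' :: 'a set set. disjoint_boxes F' \<Longrightarrow> disjoint_boxes G' \<Longrightarrow> F' \<noteq> {} \<Longrightarrow> G' \<noteq> {} \<Longrightarrow>
      card F' + card G' < card F + card G \<Longrightarrow>
      measure lebesgue (\<Union>F') powr (1 - t) * measure lebesgue (\<Union>G') powr t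
        \<le> measure lebesgue (minkowski_mix t (\<Union>F') (\<Union>G'))"
  shows "measure lebesgue (\<Union>F) powr (1 - t) * measure lebesgue (\<Union>G) powr t
    \<le> measure lebesgue (minkowski_mix t (\<Union>F) (\<Union>G))"
proof -
  let ?\<mu> = "measure lebesgue"
  let ?A = "\<Union>F" and ?B = "\<Union>G"
  obtain K K' where K: "K \<in> F" "K' \<in> F" "K \<noteq> K'"
    using F by (metis card_le_Suc0_iff_eq disjoint_boxes_def not_less_eq_eq numeral_2_eq_2)
  then have "K \<inter> K' = {}" "K \<noteq> {}" "K' \<noteq> {}" and "\<exists>a b. K = box a b" "\<exists>a b. K' = box a b"
    using F(1) by (auto simp: disjoint_boxes_def disjoint_def)
  then obtain a b a' b' where ab: "K = box a b" "K' = box a' b'" by blast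
  have "box a b \<inter> box a' b' = {}" "box a b \<noteq> {}" "box a' b' \<noteq> {}"
    using \<open>K \<inter> K' = {}\<close> \<open>K \<noteq> {}\<close> \<open>K' \<noteq> {}\<close> ab by auto
  then obtain k where k: "k \<in> Basis" "b \<bullet> k \<le> a' \<bullet> k \<or> b' \<bullet> k \<le> a \<bullet> k"
    unfolding disjoint_interval box_ne_empty by (metis not_le)
  \<comment> \<open>The boxes are open, so the upper end of the lower one serves as \<open>c\<close>
    even if their closures touch.\<close>
  then obtain c where "K \<subseteq> {x. x \<bullet> k < c} \<and> K' \<subseteq> {x. c < x \<bullet> k} \<or>
      K' \<subseteq> {x. x \<bullet> k < c} \<and> K \<subseteq> {x. c < x \<bullet> k}"
  proof (elim disjE)
    assume "b \<bullet> k \<le> a' \<bullet> k"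
    then show thesis using that[of "b \<bullet> k"] k(1) unfolding ab by (force simp: mem_box)
  next
    assume "b' \<bullet> k \<le> a \<bullet> k"
    then show thesis using that[of "b' \<bullet> k"] k(1) unfolding ab by (force simp: mem_box)
  qed
  then obtain KL KR where KL: "KL \<in> F" "KL \<subseteq> {x. x \<bullet> k < c}" and KR: "KR \<in> F" "KR \<subseteq> {x. c < x \<bullet> k}"
    using K by blast
  have KLR: "KL \<noteq> {}" "KR \<noteq> {}" "KL \<inter> {x. c < x \<bullet> k} = {}" "KR \<inter> {x. x \<bullet> k < c} = {}"
    using F(1) KL KR by (auto simp: disjoint_boxes_def subset_iff)
  have HL: "\<exists>a' b'. box u w \<inter> {x. x \<bullet> k < h} = box a' b'" for u w h
    using box_Int_halfspace(1)[OF k(1)] by blast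
  have HR: "\<exists>a' b'. box u w \<inter> {x. h < x \<bullet> k} = box a' b'" for u w h
    using box_Int_halfspace(2)[OF k(1)] by blast
  define FL where "FL = (\<lambda>K. K \<inter> {x. x \<bullet> k < c}) ` F - {{}}"
  define FR where "FR = (\<lambda>K. K \<inter> {x. c < x \<bullet> k}) ` F - {{}}"
  note FL = disjoint_boxes_Int[OF F(1) HL[of _ _ c], folded FL_def]
  note FR = disjoint_boxes_Int[OF F(1) HR[of _ _ c], folded FR_def]
  have "FL \<noteq> {}" "FR \<noteq> {}"
  proof -
    have "KL = KL \<inter> {x. x \<bullet> k < c}" "KR = KR \<inter> {x. c < x \<bullet> k}" using KL KR by auto
    then have "KL \<in> FL" "KR \<in> FR"
      unfolding FL_def FR_def using KL(1) KR(1) KLR(1,2) by blast+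
    then show "FL \<noteq> {}" "FR \<noteq> {}" by auto
  qed
  note A = disjoint_boxes_Union[OF F(1)]
  note B = disjoint_boxes_Union[OF G(1)]
  define s where "s = ?\<mu> (\<Union>FL) / ?\<mu> ?A"
  have Apos: "?\<mu> ?A > 0" using disjoint_boxes_measure_pos[OF F(1)] KL by auto
  have Bpos: "?\<mu> ?B > 0" using disjoint_boxes_measure_pos[OF G] .
  have LRpos: "?\<mu> (\<Union>FL) > 0" "?\<mu> (\<Union>FR) > 0"
    using disjoint_boxes_measure_pos FL(1) FR(1) \<open>FL \<noteq> {}\<close> \<open>FR \<noteq> {}\<close> by blast+
  have split: "?\<mu> ?A = ?\<mu> (\<Union>FL) + ?\<mu> (\<Union>FR)"
    using measure_split_hyperplane[OF A(3) k(1), of c] by (simp add: FL(2) FR(2))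
  have s: "0 < s" "s < 1" "?\<mu> (\<Union>FL) = s * ?\<mu> ?A" "?\<mu> (\<Union>FR) = (1 - s) * ?\<mu> ?A"
    using split LRpos Apos by (auto simp: s_def field_simps)
  obtain e where e: "?\<mu> (?B \<inter> {x. x \<bullet> k < e}) = s * ?\<mu> ?B"
    using halfspace_with_given_measure[OF B(3,2) k(1), of "s * ?\<mu> ?B"] s Bpos by auto
  define GL where "GL = (\<lambda>K. K \<inter> {x. x \<bullet> k < e}) ` G - {{}}"
  define GR where "GR = (\<lambda>K. K \<inter> {x. e < x \<bullet> k}) ` G - {{}}"
  note GL = disjoint_boxes_Int[OF G(1) HL[of _ _ e], folded GL_def]
  note GR = disjoint_boxes_Int[OF G(1) HR[of _ _ e], folded GR_def]
  have G\<mu>: "?\<mu> (\<Union>GL) = s * ?\<mu> ?B" "?\<mu> (\<Union>GR) = (1 - s) * ?\<mu> ?B"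
    using measure_split_hyperplane[OF B(3) k(1), of e] e by (simp_all add: GL(2) GR(2) algebra_simps)
  have "?\<mu> (\<Union>GL) > 0" "?\<mu> (\<Union>GR) > 0" using G\<mu> s Bpos by simp_all
  then have "GL \<noteq> {}" "GR \<noteq> {}" by auto
  let ?XL = "minkowski_mix t (\<Union>FL) (\<Union>GL)" and ?XR = "minkowski_mix t (\<Union>FR) (\<Union>GR)"
  have scale: "(q * ?\<mu> ?A) powr (1 - t) * (q * ?\<mu> ?B) powr t = q * (?\<mu> ?A powr (1 - t) * ?\<mu> ?B powr t)"
    if "q > 0" for q
  proof -
    have "(q * ?\<mu> ?A) powr (1 - t) * (q * ?\<mu> ?B) powr t
      = (q powr (1 - t) * q powr t) * (?\<mu> ?A powr (1 - t) * ?\<mu> ?B powr t)"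
      using that Apos Bpos by (simp add: powr_mult)
    also have "q powr (1 - t) * q powr t = q" using that by (simp flip: powr_add)
    finally show ?thesis .
  qed
  \<comment> \<open>\<open>FL\<close> has lost \<open>KR\<close>, while \<open>GL\<close> has at
    most as many boxes as \<open>G\<close>: the total count drops although \<open>G\<close> itself
    need not shrink.\<close>
  have L: "s * (?\<mu> ?A powr (1 - t) * ?\<mu> ?B powr t) \<le> ?\<mu> ?XL"
    using IH[OF FL(1) GL(1) \<open>FL \<noteq> {}\<close> \<open>GL \<noteq> {}\<close>] FL(4)[OF KR(1) KLR(4)] GL(3) scale[OF s(1)]
    by (simp add: s G\<mu>)
  have R: "(1 - s) * (?\<mu> ?A powr (1 - t) * ?\<mu> ?B powr t) \<le> ?\<mu> ?XR"
    using IH[OF FR(1) GR(1) \<open>FR \<noteq> {}\<close> \<open>GR \<noteq> {}\<close>] FR(4)[OF KL(1) KLR(3)] GR(3) scale[of "1 - s"] s(1,2)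
    by (simp add: s G\<mu>)
  have meas: "?XL \<in> lmeasurable" "?XR \<in> lmeasurable" "minkowski_mix t ?A ?B \<in> lmeasurable"
    using disjoint_boxes_Union FL(1) GL(1) FR(1) GR(1) F(1) G(1) t
    by (auto intro!: lmeasurable_minkowski_mix)
  \<comment> \<open>The mixed hyperplane at height \<open>(1 - t) * c + t * e\<close> separates the
    two mixes strictly.\<close>
  have disj: "?XL \<inter> ?XR = {}"
  proof -
    have "z \<bullet> k < (1 - t) * c + t * e" if "z \<in> ?XL" for z
      using that t unfolding FL(2) GL(2) minkowski_mix_def
      by (auto simp: inner_add_left intro!: add_strict_mono)
    moreover have "(1 - t) * c + t * e < z \<bullet> k" if "z \<in> ?XR" for z
      using that t unfolding FR(2) GR(2) minkowski_mix_def
      by (auto simp: inner_add_left intro!: add_strict_mono)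
    ultimately show ?thesis by fastforce
  qed
  have "?\<mu> ?A powr (1 - t) * ?\<mu> ?B powr t \<le> ?\<mu> ?XL + ?\<mu> ?XR"
    using L R by (simp add: algebra_simps)
  also have "\<dots> = ?\<mu> (?XL \<union> ?XR)"
    using measure_Un3[OF meas(1,2)] disj by simp
  also have "\<dots> \<le> ?\<mu> (minkowski_mix t ?A ?B)"
  proof (rule measure_mono_fmeasurable)
    show "?XL \<union> ?XR \<subseteq> minkowski_mix t ?A ?B"
      unfolding FL(2) GL(2) FR(2) GR(2) by (intro Un_least minkowski_mix_mono) auto
  qed (use meas in auto)
  finally show ?thesis .
qed

text \<open>If only \<open>G\<close> can be split, the roles are exchanged, which turns
  \<open>t\<close> into \<open>1 - t\<close>; hence the induction generalises
  \<open>t\<close>.\<close>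

lemma brunn_minkowski_disjoint_boxes:
  fixes F G :: "'a::euclidean_space set set"
  assumes "disjoint_boxes F" "disjoint_boxes G" "F \<noteq> {}" "G \<noteq> {}" "0 < t" "t < 1"
  shows "measure lebesgue (\<Union>F) powr (1 - t) * measure lebesgue (\<Union>G) powr t
    \<le> measure lebesgue (minkowski_mix t (\<Union>F) (\<Union>G))"
  using assms
proof (induction "card F + card G" arbitrary: F G t rule: less_induct)
  case less
  have fin: "finite F" "finite G" using less.prems by (auto simp: disjoint_boxes_def)
  consider "2 \<le> card F" | "2 \<le> card G" | "card F = 1" "card G = 1"
    using less.prems fin
    by (metis One_nat_def Suc_leI card_gt_0_iff le_antisym not_less_eq_eq numeral_2_eq_2)
  then show ?case
  proof cases
    case 1
    show ?thesis
      by (rule brunn_minkowski_split[OF less.prems(1) 1 less.prems(2,4-6)]) (use less in auto)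
  next
    case 2
    have "measure lebesgue (\<Union>G) powr (1 - (1 - t)) * measure lebesgue (\<Union>F) powr (1 - t)
      \<le> measure lebesgue (minkowski_mix (1 - t) (\<Union>G) (\<Union>F))"
    proof (rule brunn_minkowski_split[OF less.prems(2) 2 less.prems(1,3)])
      fix F' G' :: "'a set set"
      assume "disjoint_boxes F'" "disjoint_boxes G'" "F' \<noteq> {}" "G' \<noteq> {}"
        "card F' + card G' < card G + card F"
      then show "measure lebesgue (\<Union>F') powr (1 - (1 - t)) * measure lebesgue (\<Union>G') powr (1 - t)
        \<le> measure lebesgue (minkowski_mix (1 - t) (\<Union>F') (\<Union>G'))"
        using less.prems by (intro less.hyps) auto
    qed (use less.prems in auto)
    then show ?thesis by (simp add: mult.commute minkowski_mix_swap[of t])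
  next
    case 3
    then obtain K K' where "F = {K}" "G = {K'}" by (metis card_1_singletonE)
    then show ?thesis
      using less.prems by (auto simp: disjoint_boxes_def intro!: brunn_minkowski_box)
  qed
qed

section \<open>From boxes to bounded open sets\<close>

lemma open_approx_disjoint_boxes:
  fixes S :: "'a::euclidean_space set"
  assumes "open S" "bounded S" "0 \<le> m" "m < measure lebesgue S"
  obtains F where "disjoint_boxes F" "F \<noteq> {}" "\<Union>F \<subseteq> S" "m < measure lebesgue (\<Union>F)"
proof -
  obtain l where l: "S \<subseteq> cbox (- l) l" using assms(2) bounded_subset_cbox_symmetric by blast
  have "S \<noteq> {}" using assms by auto
  then have "interior (cbox (- l) l) \<noteq> {}" using l assms(1) by (metis interior_maximal subset_empty)
  then have ne: "box (- l) l \<noteq> {}" by (simp add: interior_cbox)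
  \<comment> \<open>With this gauge every cell of the covering, having its tag in \<open>S\<close>,
    lies inside \<open>S\<close>, so the cells fill \<open>S\<close> exactly.\<close>
  define g where "g x = (if x \<in> S then S else UNIV)" for x
  have "gauge g" using assms(1) by (auto simp: gauge_def g_def)
  obtain D where D: "countable D" "\<And>K. K \<in> D \<Longrightarrow> interior K \<noteq> {} \<and> (\<exists>c d. K = cbox c d)"
    "pairwise (\<lambda>A B. interior A \<inter> interior B = {}) D"
    "\<And>K. K \<in> D \<Longrightarrow> \<exists>x\<in>S \<inter> K. K \<subseteq> g x" "S \<subseteq> \<Union>D"
    using covering_lemma[OF l ne \<open>gauge g\<close>] by metis
  have US: "\<Union>D = S" using D(4,5) by (fastforce simp: g_def)
  then have "D \<noteq> {}" using \<open>S \<noteq> {}\<close> by auto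
  define f where "f = from_nat_into D"
  have rf: "range f = D" using \<open>D \<noteq> {}\<close> D(1) by (simp add: f_def range_from_nat_into)
  define A where "A n = (\<Union>k<n. f k)" for n :: nat
  have fbox: "\<exists>c d. f k = cbox c d" for k using D(2) rf by blast
  have Am: "A n \<in> lmeasurable" for n
    unfolding A_def using fbox by (intro fmeasurable.finite_UN) (auto, metis lmeasurable_cbox)
  have UA: "(\<Union>n. A n) = S" using rf US by (force simp: A_def)
  have "(\<lambda>n. measure lebesgue (A n)) \<longlonglongrightarrow> measure lebesgue (\<Union>n. A n)"
  proof (rule Lim_measure_incseq)
    show "incseq A" by (fastforce simp: incseq_def A_def)
    show "emeasure lebesgue (\<Union>n. A n) \<noteq> \<infinity>"
      unfolding UA using lmeasurable_open[OF assms(2,1)] fmeasurableD2 by fastforce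
  qed (use Am in auto)
  then have "\<forall>\<^sub>F n in sequentially. m < measure lebesgue (A n)"
    using order_tendstoD(1) assms(4) UA by metis
  then obtain n where n: "m < measure lebesgue (A n)" by (auto simp: eventually_sequentially)
  define F where "F = (\<lambda>k. interior (f k)) ` {..<n}"
  have fD: "f k \<in> D" for k using rf by blast
  have box: "disjoint_boxes F"
    unfolding disjoint_boxes_def
  proof (intro conjI ballI)
    show "finite F" by (simp add: F_def)
    show "disjoint F"
      unfolding disjoint_def
    proof (intro ballI impI)
      fix K L assume "K \<in> F" "L \<in> F" "K \<noteq> L"
      then obtain i j where "K = interior (f i)" "L = interior (f j)" "f i \<noteq> f j"
        unfolding F_def by (metis imageE)
      then show "K \<inter> L = {}" using pairwiseD[OF D(3) fD fD] by simp
    qed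
    fix K assume "K \<in> F"
    then obtain k where k: "K = interior (f k)" by (auto simp: F_def)
    show "K \<noteq> {}" using D(2) fD k by auto
    show "\<exists>a b. K = box a b" using fbox[of k] k by (metis interior_cbox)
  qed
  have sub: "\<Union>F \<subseteq> A n" using interior_subset by (fastforce simp: F_def A_def)
  \<comment> \<open>Replacing cells by their interiors makes them disjoint open boxes and loses only
    frontiers of boxes.\<close>
  have neg: "negligible (A n - \<Union>F)"
  proof (rule negligible_subset)
    show "A n - \<Union>F \<subseteq> (\<Union>k<n. frontier (f k))"
      using closure_subset by (fastforce simp: A_def F_def frontier_def)
    show "negligible (\<Union>k<n. frontier (f k))"
      using fbox by (intro negligible_Union) (auto, metis convex_box(1) negligible_convex_frontier)
  qed
  have "measure lebesgue (\<Union>F) = measure lebesgue (A n)"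
    using sub neg by (intro measure_negligible_symdiff Am) (simp add: Diff_eq_empty_iff[THEN iffD2])
  moreover have "\<Union>F \<subseteq> S" using sub UA by auto
  moreover have "F \<noteq> {}" using n assms(3) by (cases "n = 0") (auto simp: A_def F_def)
  ultimately show thesis using that[of F] box n by simp
qed

text \<open>Box families capturing a fraction \<open>q < 1\<close> of both volumes give the
  inequality up to the factor \<open>q\<close>, and \<open>q\<close> is arbitrarily close to
  1.\<close>

theorem brunn_minkowski_open:
  fixes A B :: "'a::euclidean_space set"
  assumes A: "open A" "bounded A" "0 < measure lebesgue A"
    and B: "open B" "bounded B" "0 < measure lebesgue B"
    and t: "0 < t" "t < 1"
  shows "measure lebesgue A powr (1 - t) * measure lebesgue B powr t
    \<le> measure lebesgue (minkowski_mix t A B)" (is "?\<mu> A powr _ * _ \<le> _")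
proof (rule field_le_mult_one_interval)
  fix q :: real assume q: "0 < q" "q < 1"
  obtain F where F: "disjoint_boxes F" "F \<noteq> {}" "\<Union>F \<subseteq> A" "q * ?\<mu> A < ?\<mu> (\<Union>F)"
    using open_approx_disjoint_boxes[OF A(1,2), of "q * ?\<mu> A"] q A(3) by auto
  obtain G where G: "disjoint_boxes G" "G \<noteq> {}" "\<Union>G \<subseteq> B" "q * ?\<mu> B < ?\<mu> (\<Union>G)"
    using open_approx_disjoint_boxes[OF B(1,2), of "q * ?\<mu> B"] q B(3) by auto
  have "q * (?\<mu> A powr (1 - t) * ?\<mu> B powr t)
      = (q powr (1 - t) * q powr t) * (?\<mu> A powr (1 - t) * ?\<mu> B powr t)"
    using q by (simp flip: powr_add)
  also have "\<dots> = (q * ?\<mu> A) powr (1 - t) * (q * ?\<mu> B) powr t"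
    using q by (simp add: powr_mult)
  also have "\<dots> \<le> ?\<mu> (\<Union>F) powr (1 - t) * ?\<mu> (\<Union>G) powr t"
    using F(4) G(4) t q by (intro mult_mono powr_mono2) auto
  also have "\<dots> \<le> ?\<mu> (minkowski_mix t (\<Union>F) (\<Union>G))"
    using F G t by (intro brunn_minkowski_disjoint_boxes)
  also have "\<dots> \<le> ?\<mu> (minkowski_mix t A B)"
    using F G A B t disjoint_boxes_Union[OF F(1)] disjoint_boxes_Union[OF G(1)]
    by (intro measure_mono_fmeasurable minkowski_mix_mono lmeasurable_minkowski_mix fmeasurableD) auto
  finally show "q * (?\<mu> A powr (1 - t) * ?\<mu> B powr t) \<le> ?\<mu> (minkowski_mix t A B)" .
qed

section \<open>Zonotopes with fixed directions\<close>

text \<open>The relative positions \<open>\<theta>\<close> are kept apart from the lengths, so one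
  \<open>\<theta>\<close> can address corresponding points of zonotopes with different
  lengths.\<close>

definition zonotope :: "nat \<Rightarrow> (nat \<Rightarrow> 'a::real_vector) \<Rightarrow> 'a \<Rightarrow> (nat \<Rightarrow> real) \<Rightarrow> 'a set" where
  "zonotope k v p \<alpha> = {p + (\<Sum>i=1..k. (\<theta> i * \<alpha> i) *\<^sub>R v i) | \<theta>. \<forall>i\<in>{1..k}. 0 \<le> \<theta> i \<and> \<theta> i \<le> 1}"

lemma zonotope_eq_Minkowski_sum:
  "zonotope k v p \<alpha> = (+) p ` (\<Sum>i\<in>{1..k}. closed_segment 0 (\<alpha> i *\<^sub>R v i))"
proof -
  have "(\<Sum>i\<in>{1..k}. closed_segment 0 (\<alpha> i *\<^sub>R v i)) =
    {\<Sum>i=1..k. (\<theta> i * \<alpha> i) *\<^sub>R v i | \<theta>. \<forall>i\<in>{1..k}. 0 \<le> \<theta> i \<and> \<theta> i \<le> 1}" (is "_ = ?R")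
  proof -
    have "(\<exists>s. z = sum s {1..k} \<and> (\<forall>i\<in>{1..k}. s i \<in> closed_segment 0 (\<alpha> i *\<^sub>R v i))) \<longleftrightarrow> z \<in> ?R" for z
    proof
      assume "\<exists>s. z = sum s {1..k} \<and> (\<forall>i\<in>{1..k}. s i \<in> closed_segment 0 (\<alpha> i *\<^sub>R v i))"
      then obtain s where s: "z = sum s {1..k}" "\<forall>i\<in>{1..k}. \<exists>u. s i = (u * \<alpha> i) *\<^sub>R v i \<and> 0 \<le> u \<and> u \<le> 1"
        by (auto simp: closed_segment_def)
      then obtain \<theta> where "\<forall>i\<in>{1..k}. s i = (\<theta> i * \<alpha> i) *\<^sub>R v i \<and> 0 \<le> \<theta> i \<and> \<theta> i \<le> 1"
        using bchoice[OF s(2)] by blast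
      then show "z \<in> ?R" using s(1) by (auto intro!: exI[of _ \<theta>] sum.cong)
    next
      assume "z \<in> ?R"
      then obtain \<theta> where "z = (\<Sum>i=1..k. (\<theta> i * \<alpha> i) *\<^sub>R v i)" "\<forall>i\<in>{1..k}. 0 \<le> \<theta> i \<and> \<theta> i \<le> 1" by blast
      then show "\<exists>s. z = sum s {1..k} \<and> (\<forall>i\<in>{1..k}. s i \<in> closed_segment 0 (\<alpha> i *\<^sub>R v i))"
        by (intro exI[of _ "\<lambda>i. (\<theta> i * \<alpha> i) *\<^sub>R v i"]) (auto simp: closed_segment_def)
    qed
    then show ?thesis by (subst set_sum_alt) blast+
  qed
  then show ?thesis by (auto simp: zonotope_def)
qed

lemma is_zonotope_iff:
  "is_zonotope k v Z \<longleftrightarrow> (\<exists>p \<alpha>. (\<forall>i\<in>{1..k}. 0 \<le> \<alpha> i) \<and> Z = zonotope k v p \<alpha>)"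
  by (simp add: is_zonotope_def zonotope_eq_Minkowski_sum)

lemma convex_zonotope: "convex (zonotope k v p \<alpha>)"
  unfolding zonotope_eq_Minkowski_sum
  by (intro convex_translation convex_set_sum convex_closed_segment)

lemma bounded_zonotope:
  fixes v :: "nat \<Rightarrow> 'a::real_normed_vector"
  shows "bounded (zonotope k v p \<alpha>)"
  unfolding bounded_iff
proof (intro exI ballI)
  fix z assume "z \<in> zonotope k v p \<alpha>"
  then obtain \<theta> where \<theta>: "\<forall>i\<in>{1..k}. 0 \<le> \<theta> i \<and> \<theta> i \<le> 1"
    and z: "z = p + (\<Sum>i=1..k. (\<theta> i * \<alpha> i) *\<^sub>R v i)" by (auto simp: zonotope_def)
  have "norm (\<Sum>i=1..k. (\<theta> i * \<alpha> i) *\<^sub>R v i) \<le> (\<Sum>i=1..k. \<bar>\<alpha> i\<bar> * norm (v i))"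
    using \<theta> by (intro sum_norm_le) (auto simp: abs_mult mult_left_le_one_le intro!: mult_right_mono)
  then show "norm z \<le> norm p + (\<Sum>i=1..k. \<bar>\<alpha> i\<bar> * norm (v i))"
    unfolding z by (rule norm_triangle_mono[OF order_refl])
qed

lemma mem_zonotopeI:
  assumes "\<And>i. i \<in> {1..k} \<Longrightarrow> 0 \<le> \<sigma> i \<and> \<sigma> i \<le> \<alpha> i"
  shows "p + (\<Sum>i=1..k. \<sigma> i *\<^sub>R v i) \<in> zonotope k v p \<alpha>"
proof -
  \<comment> \<open>If \<open>\<alpha> i = 0\<close> then \<open>\<sigma> i = 0\<close> too, and
    division by zero yields the admissible position 0.\<close>
  have "\<sigma> i = \<sigma> i / \<alpha> i * \<alpha> i \<and> 0 \<le> \<sigma> i / \<alpha> i \<and> \<sigma> i / \<alpha> i \<le> 1" if "i \<in> {1..k}" for i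
    using assms[OF that] by (auto simp: divide_le_eq_1)
  then show ?thesis
    unfolding zonotope_def by (intro CollectI exI[of _ "\<lambda>i. \<sigma> i / \<alpha> i"]) (auto intro!: sum.cong)
qed

lemma zonotope_mono:
  assumes "\<And>i. i \<in> {1..k} \<Longrightarrow> 0 \<le> \<alpha> i \<and> \<alpha> i \<le> \<beta> i"
  shows "zonotope k v p \<alpha> \<subseteq> zonotope k v p \<beta>"
proof
  fix z assume "z \<in> zonotope k v p \<alpha>"
  then obtain \<theta> where \<theta>: "\<forall>i\<in>{1..k}. 0 \<le> \<theta> i \<and> \<theta> i \<le> 1"
    and z: "z = p + (\<Sum>i=1..k. (\<theta> i * \<alpha> i) *\<^sub>R v i)" by (auto simp: zonotope_def)
  show "z \<in> zonotope k v p \<beta>"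
    unfolding z
  proof (rule mem_zonotopeI)
    fix i assume i: "i \<in> {1..k}"
    then have "\<theta> i * \<alpha> i \<le> \<alpha> i" using \<theta> assms by (simp add: mult_left_le_one_le)
    then show "0 \<le> \<theta> i * \<alpha> i \<and> \<theta> i * \<alpha> i \<le> \<beta> i" using \<theta> assms[OF i] i by auto
  qed
qed

text \<open>A point at relative positions \<open>\<theta>\<close> is the convex combination, with
  the same weights, of the points \<open>y a\<close> at positions \<open>\<theta>\<close> in the
  single zonotopes.\<close>

lemma zonotope_combination_subset_convex_hull:
  assumes A: "finite A" "\<And>a. a \<in> A \<Longrightarrow> 0 \<le> w a" "sum w A = 1"
  shows "zonotope k v (\<Sum>a\<in>A. w a *\<^sub>R p a) (\<lambda>i. \<Sum>a\<in>A. w a * \<alpha> a i)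
    \<subseteq> convex hull (\<Union>a\<in>A. zonotope k v (p a) (\<alpha> a))"
proof
  fix z assume "z \<in> zonotope k v (\<Sum>a\<in>A. w a *\<^sub>R p a) (\<lambda>i. \<Sum>a\<in>A. w a * \<alpha> a i)"
  then obtain \<theta> where \<theta>: "\<forall>i\<in>{1..k}. 0 \<le> \<theta> i \<and> \<theta> i \<le> 1"
    and z: "z = (\<Sum>a\<in>A. w a *\<^sub>R p a) + (\<Sum>i=1..k. (\<theta> i * (\<Sum>a\<in>A. w a * \<alpha> a i)) *\<^sub>R v i)"
    by (auto simp: zonotope_def)
  define y where "y a = p a + (\<Sum>i=1..k. (\<theta> i * \<alpha> a i) *\<^sub>R v i)" for a
  have "(\<Sum>i=1..k. (\<theta> i * (\<Sum>a\<in>A. w a * \<alpha> a i)) *\<^sub>R v i)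
      = (\<Sum>i=1..k. \<Sum>a\<in>A. w a *\<^sub>R (\<theta> i * \<alpha> a i) *\<^sub>R v i)"
    by (simp add: sum_distrib_left scaleR_sum_left algebra_simps)
  also have "\<dots> = (\<Sum>a\<in>A. w a *\<^sub>R (\<Sum>i=1..k. (\<theta> i * \<alpha> a i) *\<^sub>R v i))"
    by (subst sum.swap) (simp add: scaleR_sum_right)
  finally have "z = (\<Sum>a\<in>A. w a *\<^sub>R y a)"
    by (simp add: z y_def scaleR_right_distrib sum.distrib)
  moreover have "y a \<in> convex hull (\<Union>a\<in>A. zonotope k v (p a) (\<alpha> a))" if "a \<in> A" for a
    using \<theta> that by (intro hull_inc) (auto simp: zonotope_def y_def)
  ultimately show "z \<in> convex hull (\<Union>a\<in>A. zonotope k v (p a) (\<alpha> a))"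
    using A by (auto intro!: convex_sum)
qed

text \<open>This inclusion carries a lower volume bound from the mix over to the zonotope with mixed
  parameters.\<close>

lemma minkowski_mix_zonotope_subset:
  assumes "\<And>i. i \<in> {1..k} \<Longrightarrow> 0 \<le> \<alpha> i" "\<And>i. i \<in> {1..k} \<Longrightarrow> 0 \<le> \<beta> i" "0 \<le> t" "t \<le> 1"
  shows "minkowski_mix t (zonotope k v p \<alpha>) (zonotope k v q \<beta>)
    \<subseteq> zonotope k v ((1 - t) *\<^sub>R p + t *\<^sub>R q) (\<lambda>i. (1 - t) * \<alpha> i + t * \<beta> i)"
proof
  fix z assume "z \<in> minkowski_mix t (zonotope k v p \<alpha>) (zonotope k v q \<beta>)"
  then obtain \<theta> \<eta> where \<theta>: "\<forall>i\<in>{1..k}. 0 \<le> \<theta> i \<and> \<theta> i \<le> 1" "\<forall>i\<in>{1..k}. 0 \<le> \<eta> i \<and> \<eta> i \<le> 1"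
    and z: "z = (1 - t) *\<^sub>R (p + (\<Sum>i=1..k. (\<theta> i * \<alpha> i) *\<^sub>R v i)) + t *\<^sub>R (q + (\<Sum>i=1..k. (\<eta> i * \<beta> i) *\<^sub>R v i))"
    by (auto simp: zonotope_def minkowski_mix_def)
  have "z = ((1 - t) *\<^sub>R p + t *\<^sub>R q) + (\<Sum>i=1..k. ((1 - t) * (\<theta> i * \<alpha> i) + t * (\<eta> i * \<beta> i)) *\<^sub>R v i)"
    unfolding z scaleR_right_distrib scaleR_sum_right scaleR_left_distrib sum.distrib scaleR_scaleR
    by (simp add: add_ac)
  also have "\<dots> \<in> zonotope k v ((1 - t) *\<^sub>R p + t *\<^sub>R q) (\<lambda>i. (1 - t) * \<alpha> i + t * \<beta> i)"
  proof (rule mem_zonotopeI)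
    fix i assume i: "i \<in> {1..k}"
    then have "\<theta> i * \<alpha> i \<le> \<alpha> i" "\<eta> i * \<beta> i \<le> \<beta> i" "0 \<le> \<theta> i * \<alpha> i" "0 \<le> \<eta> i * \<beta> i"
      using \<theta> assms(1,2)[OF i] by (auto simp: mult_left_le_one_le)
    then show "0 \<le> (1 - t) * (\<theta> i * \<alpha> i) + t * (\<eta> i * \<beta> i) \<and>
      (1 - t) * (\<theta> i * \<alpha> i) + t * (\<eta> i * \<beta> i) \<le> (1 - t) * \<alpha> i + t * \<beta> i"
      using assms(3,4) by (auto intro!: add_mono mult_left_mono)
  qed
  finally show "z \<in> zonotope k v ((1 - t) *\<^sub>R p + t *\<^sub>R q) (\<lambda>i. (1 - t) * \<alpha> i + t * \<beta> i)" .
qed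

section \<open>Volumes of combined zonotopes\<close>

lemma measure_interior_zonotope:
  fixes v :: "nat \<Rightarrow> 'a::euclidean_space"
  shows "measure lebesgue (interior (zonotope k v p \<alpha>)) = measure lebesgue (zonotope k v p \<alpha>)"
  by (intro measure_interior bounded_zonotope negligible_convex_frontier convex_zonotope)

text \<open>Both factors of the multiplicative bound are at least 1. Brunn-Minkowski is available
  for open sets, so it is applied to interiors, which have full volume.\<close>

lemma measure_zonotope_mix_ge_1:
  fixes v :: "nat \<Rightarrow> 'a::euclidean_space"
  assumes nn: "\<And>i. i \<in> {1..k} \<Longrightarrow> 0 \<le> \<alpha> i" "\<And>i. i \<in> {1..k} \<Longrightarrow> 0 \<le> \<beta> i" and t: "0 \<le> t" "t \<le> 1"
    and ge: "1 \<le> measure lebesgue (zonotope k v p \<alpha>)" "1 \<le> measure lebesgue (zonotope k v q \<beta>)"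
  shows "1 \<le> measure lebesgue (zonotope k v ((1 - t) *\<^sub>R p + t *\<^sub>R q) (\<lambda>i. (1 - t) * \<alpha> i + t * \<beta> i))"
proof (cases "t = 0 \<or> t = 1")
  case True
  then show ?thesis using ge by auto
next
  case False
  then have t': "0 < t" "t < 1" using t by auto
  let ?A = "interior (zonotope k v p \<alpha>)" and ?B = "interior (zonotope k v q \<beta>)"
  have AB: "1 \<le> measure lebesgue ?A" "1 \<le> measure lebesgue ?B"
    using ge by (simp_all only: measure_interior_zonotope)
  have "1 * 1 \<le> measure lebesgue ?A powr (1 - t) * measure lebesgue ?B powr t"
    using AB t by (intro mult_mono ge_one_powr_ge_zero) auto
  also have "\<dots> \<le> measure lebesgue (minkowski_mix t ?A ?B)"
    using AB t' by (intro brunn_minkowski_open) (auto intro: bounded_interior bounded_zonotope)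
  also have "\<dots> \<le> measure lebesgue (zonotope k v ((1 - t) *\<^sub>R p + t *\<^sub>R q) (\<lambda>i. (1 - t) * \<alpha> i + t * \<beta> i))"
  proof (rule measure_mono_fmeasurable)
    show "minkowski_mix t ?A ?B \<subseteq> zonotope k v ((1 - t) *\<^sub>R p + t *\<^sub>R q) (\<lambda>i. (1 - t) * \<alpha> i + t * \<beta> i)"
      using minkowski_mix_mono[OF interior_subset interior_subset]
        minkowski_mix_zonotope_subset[OF nn t] by (rule order_trans)
    show "minkowski_mix t ?A ?B \<in> sets lebesgue"
      using t' by (intro fmeasurableD lmeasurable_minkowski_mix bounded_interior bounded_zonotope) auto
  qed (simp add: measurable_convex convex_zonotope bounded_zonotope)
  finally show ?thesis by simp
qed

text \<open>One index keeps its weight \<open>1 - s\<close> and the others are rescaled by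
  \<open>s\<close>, which leaves a mix of two zonotopes; for \<open>s = 0\<close> only the one index
  counts.\<close>

lemma measure_zonotope_combination_ge_1:
  fixes v :: "nat \<Rightarrow> 'a::euclidean_space"
  assumes "finite A" "A \<noteq> {}" "\<And>a i. a \<in> A \<Longrightarrow> i \<in> {1..k} \<Longrightarrow> 0 \<le> \<alpha> a i"
    "\<And>a. a \<in> A \<Longrightarrow> 1 \<le> measure lebesgue (zonotope k v (p a) (\<alpha> a))"
    "\<And>a. a \<in> A \<Longrightarrow> 0 \<le> w a" "sum w A = 1"
  shows "1 \<le> measure lebesgue (zonotope k v (\<Sum>a\<in>A. w a *\<^sub>R p a) (\<lambda>i. \<Sum>a\<in>A. w a * \<alpha> a i))"
  using assms
proof (induction A arbitrary: w rule: finite_ne_induct)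
  case (singleton a)
  then show ?case by simp
next
  case (insert a A)
  define s where "s = sum w A"
  have wa: "w a = 1 - s" using insert by (simp add: s_def)
  have s: "0 \<le> s" "s \<le> 1"
    using insert.prems(3) wa by (auto simp: s_def sum_nonneg, metis diff_ge_0_iff_ge insertI1)
  show ?case
  proof (cases "s = 0")
    case True
    then have "\<forall>b\<in>A. w b = 0"
      using insert.hyps(1) insert.prems(3) unfolding s_def by (subst (asm) sum_nonneg_eq_0_iff) auto
    then show ?thesis using insert True wa by simp
  next
    case False
    define u where "u b = w b / s" for b
    have u: "w b = s * u b" for b using False by (simp add: u_def)
    have IH: "1 \<le> measure lebesgue (zonotope k v (\<Sum>a\<in>A. u a *\<^sub>R p a) (\<lambda>i. \<Sum>a\<in>A. u a * \<alpha> a i))"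
    proof (rule insert.IH)
      show "sum u A = 1" using False by (simp add: u_def s_def flip: sum_divide_distrib)
    qed (use insert.prems s in \<open>auto simp: u_def\<close>)
    have nn: "0 \<le> (\<Sum>a\<in>A. u a * \<alpha> a i)" if "i \<in> {1..k}" for i
      using insert.prems s that by (intro sum_nonneg mult_nonneg_nonneg) (auto simp: u_def)
    have "1 \<le> measure lebesgue (zonotope k v ((1 - s) *\<^sub>R p a + s *\<^sub>R (\<Sum>a\<in>A. u a *\<^sub>R p a))
        (\<lambda>i. (1 - s) * \<alpha> a i + s * (\<Sum>a\<in>A. u a * \<alpha> a i)))"
      using insert.prems s nn IH by (intro measure_zonotope_mix_ge_1) auto
    moreover have "s *\<^sub>R (\<Sum>a\<in>A. u a *\<^sub>R p a) = (\<Sum>a\<in>A. w a *\<^sub>R p a)"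
      by (simp add: scaleR_sum_right u)
    moreover have "s * (\<Sum>a\<in>A. u a * \<alpha> a i) = (\<Sum>a\<in>A. w a * \<alpha> a i)" for i
      by (simp add: sum_distrib_left u mult.assoc)
    ultimately show ?thesis using insert.hyps by (simp add: wa)
  qed
qed

section \<open>Tverberg partitions of zonotopes\<close>

theorem theorem4p3:
  fixes v :: "nat \<Rightarrow> real ^ 'n"
    and Z :: "'i \<Rightarrow> (real ^ 'n) set"
    and I :: "'i set"
    and k r :: nat
  assumes "CARD('n) \<le> k"
    and "1 \<le> r"
    and "\<forall>i\<in>{1..k}. v i \<noteq> 0"
    and "finite I"
    and "card I = (r - 1) * (k + CARD('n)) + 1"
    and "\<forall>i\<in>I. is_zonotope k v (Z i) \<and> 1 \<le> measure lebesgue (Z i)"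
  shows "\<exists>P. partition_on I P \<and> card P = r \<and>
    (\<exists>W. is_zonotope k v W \<and> 1 \<le> measure lebesgue W \<and>
       W \<subseteq> (\<Inter>A\<in>P. convex hull (\<Union>i\<in>A. Z i)))"
proof -
  have "0 < CARD('n)" by simp
  then have "1 \<le> k" using assms(1) by linarith
  obtain p \<alpha> where Z: "\<And>i. i \<in> I \<Longrightarrow> Z i = zonotope k v (p i) (\<alpha> i)"
    and \<alpha>: "\<And>i m. i \<in> I \<Longrightarrow> m \<in> {1..k} \<Longrightarrow> 0 \<le> \<alpha> i m"
    using assms(6) unfolding is_zonotope_iff by metis
  \<comment> \<open>The last length \<open>\<alpha> i k\<close> is left out: zonotopes differing only there are nested, so
    the parts need not agree on it, and this saves one dimension.\<close>
  define Q where "Q = Inl ` (UNIV :: 'n set) \<union> Inr ` {1..<k}"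
  define x where "x i q = (case q of Inl n \<Rightarrow> p i $ n | Inr m \<Rightarrow> \<alpha> i m)" for i q
  have "finite Q" by (simp add: Q_def)
  have "card Q = CARD('n) + (k - 1)"
    unfolding Q_def by (subst card_Un_disjoint) (auto simp: card_image)
  then have "card I = (r - 1) * (card Q + 1) + 1"
    using assms(5) \<open>1 \<le> k\<close> by (simp add: add.commute)
  then obtain s w y where s: "\<forall>i\<in>I. s i < r" and w: "\<forall>i\<in>I. 0 \<le> w i"
    and w1: "\<And>j. j < r \<Longrightarrow> (\<Sum>i\<in>{i\<in>I. s i = j}. w i) = 1"
    and y: "\<And>j q. j < r \<Longrightarrow> q \<in> Q \<Longrightarrow> (\<Sum>i\<in>{i\<in>I. s i = j}. w i * x i q) = y q"
    by (rule tverberg[OF \<open>finite Q\<close> assms(4,2), where x = x]) blast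
  define A where "A j = {i\<in>I. s i = j}" for j
  define c where "c j = (\<Sum>i\<in>A j. w i *\<^sub>R p i)" for j
  define l where "l j m = (\<Sum>i\<in>A j. w i * \<alpha> i m)" for j m
  have A: "finite (A j)" "A j \<subseteq> I" for j using assms(4) by (auto simp: A_def)
  have A1: "sum w (A j) = 1" "A j \<noteq> {}" if "j < r" for j
    using w1[OF that, folded A_def] by auto
  \<comment> \<open>The \<open>Inl\<close> coordinates of Tverberg's common point \<open>y\<close>
    form the shared base point; its \<open>Inr\<close> coordinates are the shared lengths below
    index \<open>k\<close>.\<close>
  have c: "c j = c j'" if "j < r" "j' < r" for j j'
  proof -
    have "c j $ n = y (Inl n)" if "j < r" for j n
      using y[OF that, of "Inl n"] by (simp add: c_def A_def Q_def x_def)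
    then show ?thesis using that by (simp add: vec_eq_iff)
  qed
  have l: "l j m = l j' m" if "j < r" "j' < r" "m \<in> {1..<k}" for j j' m
    using y[OF that(1), of "Inr m"] y[OF that(2), of "Inr m"] that(3)
    by (simp add: l_def A_def Q_def x_def)
  have l0: "0 \<le> l j m" if "m \<in> {1..k}" for j m
    unfolding l_def using that
    by (intro sum_nonneg mult_nonneg_nonneg \<alpha> w[rule_format]) (auto simp: A_def)
  obtain j0 where j0: "j0 < r" and min: "\<And>j. j < r \<Longrightarrow> l j0 k \<le> l j k"
  proof -
    have "\<exists>j0\<in>{..<r}. \<forall>j\<in>{..<r}. l j0 k \<le> l j k"
      using assms(2)
      by (intro bexI[of _ "arg_min_on (\<lambda>j. l j k) {..<r}"] ballI arg_min_least arg_min_if_finite(1))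
        (auto simp: lessThan_empty_iff)
    then show thesis using that by auto
  qed
  define P where "P = A ` {..<r}"
  define W where "W = zonotope k v (c j0) (l j0)"
  \<comment> \<open>Distinct fibres of \<open>s\<close> are disjoint, and none is empty because its
    weights add up to 1; so there are exactly \<open>r\<close> parts.\<close>
  have "inj_on A {..<r}"
    using A1(2) by (force simp: inj_on_def A_def)
  then have "card P = r" by (simp add: P_def card_image)
  moreover have "partition_on I P"
    using s A1(2) by (intro partition_onI) (auto simp: P_def A_def disjnt_def)
  moreover have "is_zonotope k v W"
    unfolding is_zonotope_iff W_def using l0 by blast
  moreover have "1 \<le> measure lebesgue W"
    unfolding W_def c_def l_def
  proof (rule measure_zonotope_combination_ge_1[OF A(1) A1(2)[OF j0]])
    fix i assume "i \<in> A j0"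
    then have i: "i \<in> I" using A(2) by blast
    show "1 \<le> measure lebesgue (zonotope k v (p i) (\<alpha> i))" using assms(6) i by (simp flip: Z)
    show "0 \<le> w i" using w i by blast
    show "0 \<le> \<alpha> i m" if "m \<in> {1..k}" for m using \<alpha> i that by blast
  qed (use A1(1)[OF j0] in simp)
  moreover have "W \<subseteq> convex hull (\<Union>i\<in>A j. Z i)" if "j < r" for j
  proof -
    have "W \<subseteq> zonotope k v (c j) (l j)"
      unfolding W_def c[OF j0 that]
    proof (rule zonotope_mono)
      fix m assume m: "m \<in> {1..k}"
      then show "0 \<le> l j0 m \<and> l j0 m \<le> l j m"
        using l0 min[OF that] l[OF j0 that, of m] by (cases "m = k") auto
    qed
    also have "\<dots> \<subseteq> convex hull (\<Union>i\<in>A j. zonotope k v (p i) (\<alpha> i))"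
      unfolding c_def l_def using A A1(1)[OF that]
      by (intro zonotope_combination_subset_convex_hull w[rule_format]) auto
    also have "(\<Union>i\<in>A j. zonotope k v (p i) (\<alpha> i)) = (\<Union>i\<in>A j. Z i)"
      using A(2) Z by (intro SUP_cong) auto
    finally show ?thesis .
  qed
  ultimately show ?thesis
    by (intro exI[of _ P] conjI exI[of _ W]) (auto simp: P_def)
qed

end
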